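(* Let $N\ge 2$, let $\mathcal{G}=(\mathcal{V},\mathcal{E})$ be a simple graph with $\mathcal{V}=\{1,\dots,N\}$, let $\kappa>0$, and let $$H(q,p)=\sum_{i\in\mathcal{V}}\left(\frac{p_i^2}{2}-\cos q_i\right)+\kappa\sum_{\{i,j\}\in\mathcal{E}}G(q_i-q_j,p_i-p_j),\qquad (q,p)\in\mathbb{R}^N\times\mathbb{R}^N.$$ Then for $H\le 2-N$ the orbits of the Hamiltonian system $$\dot q_i=p_i+\kappa\sum_{j=1}^N a_{ij}\,G_{01}(q_i-q_j,p_i-p_j),\qquad \dot p_i=-\sin q_i-\kappa\sum_{j=1}^N a_{ij}\,G_{10}(q_i-q_j,p_i-p_j),\qquad i\in\mathcal{V},$$ are bounded; that is, every orbit whose (conserved) energy satisfies $H\le 2-N$ is bounded in $\mathbb{R}^{2N}$.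
   Context: $(a_{ij})$ is the adjacency matrix of $\mathcal{G}$. The interaction $G:\mathbb{R}^2\to\mathbb{R}$ is analytic of the form $G(x,y)=\sum_{l,m=0}^\infty c_{lm}x^{2l}y^{2m}$ with $c_{lm}\in\mathbb{R}$, and $G\ge 0$. Partial derivatives are written $G_{ij}(x,y)=\frac{\partial^{i+j}G}{\partial x^i\partial y^j}(x,y)$. Positions $q_i$ are taken in $\mathbb{R}$ (not modulo $2\pi$). *)

theory Defs
  imports "HOL-Analysis.Analysis"
begin

(* A simple graph is given by its edge set, a set of 2-element subsets of the vertex set.
   The vertex set is the whole type 'n; a finite linearly ordered type with N elements plays
   the role of {1,...,N}. *)

definition simple_graph :: "'n set set \<Rightarrow> bool" where
  "simple_graph E \<longleftrightarrow> (\<forall>e\<in>E. card e = 2)"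

definition adjacency :: "'n set set \<Rightarrow> 'n \<Rightarrow> 'n \<Rightarrow> real" where
  "adjacency E i j = (if {i, j} \<in> E then 1 else 0)"

definition partial_deriv :: "nat \<Rightarrow> nat \<Rightarrow> (real \<Rightarrow> real \<Rightarrow> real) \<Rightarrow> real \<Rightarrow> real \<Rightarrow> real" where
  "partial_deriv i j G x y = (deriv ^^ i) (\<lambda>u. (deriv ^^ j) (\<lambda>v. G u v) y) x"

(* Each edge {i,j} is counted once, through its representative with i < j. The choice of
   representative does not matter for the interactions considered, which are even in each
   argument. *)
definition hamiltonian ::
  "real \<Rightarrow> 'n::{finite,linorder} set set \<Rightarrow> (real \<Rightarrow> real \<Rightarrow> real)
    \<Rightarrow> (real^'n::{finite,linorder}) \<times> (real^'n::{finite,linorder}) \<Rightarrow> real" where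
  "hamiltonian \<kappa> E G = (\<lambda>(q, p).
     (\<Sum>i\<in>UNIV. (p $ i)\<^sup>2 / 2 - cos (q $ i))
     + \<kappa> * (\<Sum>(i, j) | i < j \<and> {i, j} \<in> E. G (q $ i - q $ j) (p $ i - p $ j)))"

definition hamiltonian_field ::
  "real \<Rightarrow> 'n::finite set set \<Rightarrow> (real \<Rightarrow> real \<Rightarrow> real)
    \<Rightarrow> (real^'n::finite) \<times> (real^'n::finite) \<Rightarrow> (real^'n::finite) \<times> (real^'n::finite)" where
  "hamiltonian_field \<kappa> E G = (\<lambda>(q, p).
     (\<chi> i. p $ i
        + \<kappa> * (\<Sum>j\<in>UNIV. adjacency E i j * partial_deriv 0 1 G (q $ i - q $ j) (p $ i - p $ j)),
      \<chi> i. - sin (q $ i)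
        - \<kappa> * (\<Sum>j\<in>UNIV. adjacency E i j * partial_deriv 1 0 G (q $ i - q $ j) (p $ i - p $ j))))"

(* The orbit through z0 is swept out by all solutions starting at z0, on arbitrary open time
   intervals around 0 and in both time directions. When solutions are unique, it is the image
   of the maximal solution; global existence is not presupposed. *)
definition orbit :: "('a::real_normed_vector \<Rightarrow> 'a) \<Rightarrow> 'a \<Rightarrow> 'a set" where
  "orbit X z0 = {z t | z I t.
     open I \<and> is_interval I \<and> (0::real) \<in> I \<and> t \<in> I \<and> z 0 = z0 \<and>
     (\<forall>s\<in>I. (z has_vector_derivative X (z s)) (at s))}"

end

theory Submission
  imports Defs
begin

text \<open>
  Up to the additive constant \<open>N\<close>, the energy is a sum of nonnegative terms: the kinetic energies
  \<open>p\<^sub>i\<^sup>2 / 2\<close>, the pinning energies \<open>1 - cos q\<^sub>i\<close> and the interactions. The hypothesis says that the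
  conserved total of these terms is at most \<open>2\<close>. This bounds all momenta at once, and \<open>2\<close> is also
  exactly the height of the barrier between two wells of the pinning potential.

  If a position reaches the top of a barrier, where \<open>cos q\<^sub>i = -1\<close>, then this single term uses up the
  whole energy. All momenta then vanish, all other pendulums hang at the bottom, and every interaction
  \<open>G\<close> is zero, hence minimal, so that its first partial derivatives vanish as well. Such a state is an
  equilibrium (\<open>inverted_pendulum_equilibrium\<close>). An equilibrium cannot be reached in finite time from
  another state (\<open>stays_at_equilibrium\<close>), so an orbit through it is a single point. On any other orbit
  no position attains \<open>cos q\<^sub>i = -1\<close>, and by the intermediate value theorem every position stays within
  \<open>2 * pi\<close> of its initial value (\<open>cos_barrier\<close>).

  The regularity used here is that \<open>G\<close> and its first partial derivatives are Frechet differentiable: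
  for \<open>G\<close> this gives conservation of energy (\<open>hamiltonian_conserved\<close>), for the partial derivatives the
  linear bound on the vector field near an equilibrium that replaces a full uniqueness theorem for
  solutions. It holds because a power series in two variables that is summable on the whole plane can
  be differentiated term by term into series of the same kind.
\<close>

section \<open>Power series in two variables that are summable on the plane\<close>

definition double_series :: "(nat \<Rightarrow> nat \<Rightarrow> real) \<Rightarrow> real \<Rightarrow> real \<Rightarrow> real" where
  "double_series a x y = (\<Sum>\<^sub>\<infinity>(l, m). a l m * x ^ l * y ^ m)"

definition entire_coeffs :: "(nat \<Rightarrow> nat \<Rightarrow> real) \<Rightarrow> bool" where
  "entire_coeffs a \<longleftrightarrow> (\<forall>x y. (\<lambda>(l, m). a l m * x ^ l * y ^ m) summable_on UNIV)"

definition diffs1 :: "(nat \<Rightarrow> nat \<Rightarrow> real) \<Rightarrow> nat \<Rightarrow> nat \<Rightarrow> real" where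
  "diffs1 a l m = real (Suc l) * a (Suc l) m"

definition diffs2 :: "(nat \<Rightarrow> nat \<Rightarrow> real) \<Rightarrow> nat \<Rightarrow> nat \<Rightarrow> real" where
  "diffs2 a l m = real (Suc m) * a l (Suc m)"

text \<open>Exchanging the roles of the two variables reduces every statement about the second partial
  derivative to one about the first.\<close>

lemma entire_coeffs_transpose:
  assumes "entire_coeffs a"
  shows "entire_coeffs (\<lambda>l m. a m l)"
  unfolding entire_coeffs_def
proof (intro allI)
  fix x y
  have "(\<lambda>(l, m). a l m * y ^ l * x ^ m) summable_on UNIV"
    using assms by (auto simp: entire_coeffs_def)
  then have "(\<lambda>p. (\<lambda>(l, m). a l m * y ^ l * x ^ m) (prod.swap p)) summable_on UNIV"
    by (subst summable_on_reindex_bij_betw) (auto simp: bij_swap)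
  then show "(\<lambda>(l, m). a m l * x ^ l * y ^ m) summable_on UNIV"
    by (simp add: case_prod_unfold mult.assoc mult.commute mult.left_commute)
qed

lemma double_series_transpose: "double_series (\<lambda>l m. a m l) y x = double_series a x y"
proof -
  have "infsum (\<lambda>p. (\<lambda>(l, m). a l m * x ^ l * y ^ m) (prod.swap p)) UNIV
      = infsum (\<lambda>(l, m). a l m * x ^ l * y ^ m) UNIV"
    by (rule infsum_reindex_bij_betw) (simp add: bij_swap)
  then show ?thesis
    by (simp add: double_series_def case_prod_unfold mult.assoc mult.commute mult.left_commute)
qed

lemma entire_coeffs_abs:
  assumes "entire_coeffs a"
  shows "(\<lambda>(l, m). \<bar>a l m\<bar> * \<bar>x\<bar> ^ l * \<bar>y\<bar> ^ m) summable_on UNIV"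
proof -
  have "(\<lambda>(l, m). a l m * x ^ l * y ^ m) summable_on UNIV"
    using assms by (auto simp: entire_coeffs_def)
  then have "(\<lambda>p. norm ((\<lambda>(l, m). a l m * x ^ l * y ^ m) p)) summable_on UNIV"
    by (subst (asm) summable_on_iff_abs_summable_on_real)
  then show ?thesis
    by (simp add: case_prod_unfold abs_mult power_abs)
qed

text \<open>The factor \<open>l + 1\<close> produced by differentiation is dominated by \<open>2 ^ (l + 1)\<close>, hence absorbed by
  evaluating the original series at the larger radius \<open>2 * (\<bar>x\<bar> + 1)\<close>.\<close>

lemma entire_coeffs_diffs1:
  assumes "entire_coeffs a"
  shows "entire_coeffs (diffs1 a)"
  unfolding entire_coeffs_def
proof (intro allI)
  fix x y :: real
  define R where "R = 2 * (\<bar>x\<bar> + 1)"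
  have "inj (\<lambda>(l, m). (Suc l, m :: nat))"
    by (auto simp: inj_on_def)
  moreover have "(\<lambda>(l, m). \<bar>a l m\<bar> * \<bar>R\<bar> ^ l * \<bar>y\<bar> ^ m)
      summable_on (range (\<lambda>(l, m). (Suc l, m)))"
    using entire_coeffs_abs[OF assms] by (rule summable_on_subset_banach) simp
  ultimately have major: "(\<lambda>(l, m). \<bar>a (Suc l) m\<bar> * \<bar>R\<bar> ^ Suc l * \<bar>y\<bar> ^ m) summable_on UNIV"
    by (simp add: summable_on_reindex o_def case_prod_unfold)
  have "norm (diffs1 a l m * x ^ l * y ^ m) \<le> \<bar>a (Suc l) m\<bar> * \<bar>R\<bar> ^ Suc l * \<bar>y\<bar> ^ m" for l m
  proof -
    have "real (Suc l) * \<bar>x\<bar> ^ l \<le> 2 ^ Suc l * (\<bar>x\<bar> + 1) ^ Suc l"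
    proof (intro mult_mono)
      show "real (Suc l) \<le> 2 ^ Suc l"
        using less_exp[of "Suc l"] by (metis of_nat_less_numeral_power_cancel_iff order_less_imp_le)
      have "\<bar>x\<bar> ^ l \<le> (\<bar>x\<bar> + 1) ^ l" by (simp add: power_mono)
      also have "\<dots> \<le> (\<bar>x\<bar> + 1) ^ Suc l" by (rule power_increasing) auto
      finally show "\<bar>x\<bar> ^ l \<le> (\<bar>x\<bar> + 1) ^ Suc l" .
    qed auto
    also have "\<dots> = \<bar>R\<bar> ^ Suc l"
      unfolding R_def by (metis abs_ge_zero abs_of_nonneg add_increasing2 mult_nonneg_nonneg power_mult_distrib zero_le_numeral zero_le_one)
    finally have "\<bar>a (Suc l) m\<bar> * (real (Suc l) * \<bar>x\<bar> ^ l) * \<bar>y\<bar> ^ m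
        \<le> \<bar>a (Suc l) m\<bar> * \<bar>R\<bar> ^ Suc l * \<bar>y\<bar> ^ m"
      by (intro mult_mono) auto
    then show ?thesis
      by (simp add: diffs1_def abs_mult power_abs ac_simps del: of_nat_Suc)
  qed
  then have "norm ((\<lambda>(l, m). diffs1 a l m * x ^ l * y ^ m) p)
      \<le> (\<lambda>(l, m). \<bar>a (Suc l) m\<bar> * \<bar>R\<bar> ^ Suc l * \<bar>y\<bar> ^ m) p" for p
    by (cases p) (simp del: power_Suc)
  with major have "(\<lambda>p. norm ((\<lambda>(l, m). diffs1 a l m * x ^ l * y ^ m) p)) summable_on UNIV"
    by (rule Infinite_Sum.abs_summable_on_comparison_test')
  then show "(\<lambda>(l, m). diffs1 a l m * x ^ l * y ^ m) summable_on UNIV"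
    by (subst summable_on_iff_abs_summable_on_real)
qed

lemma diffs2_eq_transpose: "diffs2 a = (\<lambda>l m. diffs1 (\<lambda>l m. a m l) m l)"
  by (intro ext) (simp only: diffs1_def diffs2_def)

lemma entire_coeffs_diffs2:
  assumes "entire_coeffs a"
  shows "entire_coeffs (diffs2 a)"
proof -
  have "entire_coeffs (diffs1 (\<lambda>l m. a m l))"
    using assms by (rule entire_coeffs_diffs1[OF entire_coeffs_transpose])
  then show ?thesis
    unfolding diffs2_eq_transpose by (rule entire_coeffs_transpose)
qed

lemma double_series_iterated:
  assumes "entire_coeffs a"
  shows "(\<lambda>l. (\<Sum>\<^sub>\<infinity>m. a l m * y ^ m) * x ^ l) sums double_series a x y"
proof -
  have s: "(\<lambda>(l, m). a l m * x ^ l * y ^ m) summable_on UNIV \<times> UNIV" for x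
    using assms unfolding entire_coeffs_def UNIV_Times_UNIV by blast
  have "(\<lambda>m. a l m * y ^ m) summable_on UNIV" for l
    using summable_on_SigmaD1[OF s[of 1], of l] by simp
  then have "((\<lambda>m. (\<lambda>(l, m). a l m * x ^ l * y ^ m) (l, m)) has_sum
      (\<Sum>\<^sub>\<infinity>m. a l m * y ^ m) * x ^ l) UNIV" for l
    using has_sum_cmult_left[OF has_sum_infsum, of "\<lambda>m. a l m * y ^ m" UNIV "x ^ l"]
    by (simp add: mult.assoc mult.commute mult.left_commute)
  moreover have "((\<lambda>(l, m). a l m * x ^ l * y ^ m) has_sum double_series a x y) (UNIV \<times> UNIV)"
    using s by (simp add: double_series_def)
  ultimately have "((\<lambda>l. (\<Sum>\<^sub>\<infinity>m. a l m * y ^ m) * x ^ l) has_sum double_series a x y) UNIV"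
    by (rule has_sum_SigmaD[rotated])
  then show ?thesis
    by (rule has_sum_imp_sums)
qed

text \<open>For fixed \<open>y\<close>, summing over \<open>m\<close> first leaves an ordinary power series in \<open>x\<close>, to which the
  one-variable theorem on termwise differentiation applies.\<close>

lemma DERIV_double_series1:
  assumes "entire_coeffs a"
  shows "((\<lambda>u. double_series a u y) has_real_derivative double_series (diffs1 a) x y) (at x)"
proof -
  define b where "b l = (\<Sum>\<^sub>\<infinity>m. a l m * y ^ m)" for l
  have 1: "double_series a u y = (\<Sum>l. b l * u ^ l)" "summable (\<lambda>l. b l * u ^ l)" for u
    using double_series_iterated[OF assms, of y u] by (auto simp: b_def sums_iff)
  have "diffs b l = (\<Sum>\<^sub>\<infinity>m. diffs1 a l m * y ^ m)" for l
    by (simp add: diffs_def b_def diffs1_def mult.assoc infsum_cmult_right' del: of_nat_Suc)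
  then have "double_series (diffs1 a) x y = (\<Sum>l. diffs b l * x ^ l)"
    using double_series_iterated[OF entire_coeffs_diffs1[OF assms], of y x] by (auto simp: sums_iff)
  then show ?thesis
    using termdiffs_strong_converges_everywhere[of b x] 1 by simp
qed

lemma DERIV_double_series2:
  assumes "entire_coeffs a"
  shows "((\<lambda>v. double_series a x v) has_real_derivative double_series (diffs2 a) x y) (at y)"
proof -
  have "double_series (diffs2 a) x y = double_series (diffs1 (\<lambda>l m. a m l)) y x"
    unfolding diffs2_eq_transpose by (rule double_series_transpose)
  moreover have "double_series a x = (\<lambda>v. double_series (\<lambda>l m. a m l) v x)"
    by (intro ext double_series_transpose[symmetric])
  ultimately show ?thesis
    using DERIV_double_series1[OF entire_coeffs_transpose[OF assms], of x y] by simp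
qed

text \<open>Joint continuity comes from uniform convergence on squares. It is needed because partial
  derivatives alone do not give a total derivative.\<close>

lemma continuous_double_series:
  assumes "entire_coeffs a"
  shows "continuous (at (x, y)) (\<lambda>(x, y). double_series a x y)"
proof -
  define R where "R = max \<bar>x\<bar> \<bar>y\<bar> + 1"
  define Y where "Y = {-R..R} \<times> {-R..R}"
  have R: "R > 0" "\<bar>x\<bar> < R" "\<bar>y\<bar> < R" by (auto simp: R_def)
  have "uniform_limit Y (\<lambda>X p. \<Sum>(l, m)\<in>X. a l m * fst p ^ l * snd p ^ m)
      (\<lambda>p. \<Sum>\<^sub>\<infinity>(l, m)\<in>UNIV. a l m * fst p ^ l * snd p ^ m) (finite_subsets_at_top UNIV)"
    unfolding case_prod_unfold
  proof (rule Weierstrass_m_test_general)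
    show "(\<lambda>n. \<bar>a (fst n) (snd n)\<bar> * \<bar>R\<bar> ^ fst n * \<bar>R\<bar> ^ snd n) summable_on UNIV"
      using entire_coeffs_abs[OF assms, of R R] by (simp add: case_prod_unfold)
    fix n :: "nat \<times> nat" and p assume "p \<in> Y"
    then have "\<bar>fst p\<bar> \<le> \<bar>R\<bar>" "\<bar>snd p\<bar> \<le> \<bar>R\<bar>" by (auto simp: Y_def)
    then show "norm (a (fst n) (snd n) * fst p ^ fst n * snd p ^ snd n)
        \<le> \<bar>a (fst n) (snd n)\<bar> * \<bar>R\<bar> ^ fst n * \<bar>R\<bar> ^ snd n"
      by (auto simp: abs_mult power_abs intro!: mult_mono power_mono)
  qed
  then have "continuous_on Y (\<lambda>p. \<Sum>\<^sub>\<infinity>(l, m)\<in>UNIV. a l m * fst p ^ l * snd p ^ m)"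
    by (rule uniform_limit_theorem[rotated])
       (auto simp: case_prod_unfold intro!: always_eventually continuous_intros)
  then have "continuous_on Y (\<lambda>(x, y). double_series a x y)"
    by (simp add: double_series_def case_prod_unfold)
  moreover have "(x, y) \<in> interior Y"
    using R by (auto simp: Y_def interior_Times abs_less_iff)
  ultimately show ?thesis
    by (rule continuous_on_interior)
qed

lemma has_derivative_double_series:
  assumes "entire_coeffs a"
  shows "((\<lambda>(x, y). double_series a x y) has_derivative
    (\<lambda>(h, k). double_series (diffs1 a) x y * h + double_series (diffs2 a) x y * k)) (at (x, y))"
proof -
  have "((\<lambda>(x, y). double_series a x y) has_derivative
    (\<lambda>(h, k). double_series (diffs1 a) x y * h
       + blinfun_apply (blinfun_mult_right (double_series (diffs2 a) x y)) k))
       (at (x, y) within UNIV \<times> UNIV)"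
  proof (rule has_derivative_partialsI)
    show "((\<lambda>x. double_series a x y) has_derivative (*) (double_series (diffs1 a) x y)) (at x within UNIV)"
      using DERIV_double_series1[OF assms] by (simp add: has_field_derivative_def)
    show "(double_series a x has_derivative
        blinfun_apply (blinfun_mult_right (double_series (diffs2 a) x y))) (at y within UNIV)" for x y
      using DERIV_double_series2[OF assms] by (simp add: has_field_derivative_def)
    have "continuous (at (x, y)) (\<lambda>p. double_series (diffs2 a) (fst p) (snd p))"
      using continuous_double_series[OF entire_coeffs_diffs2[OF assms]] by (simp add: case_prod_unfold)
    then show "continuous (at (x, y) within UNIV \<times> UNIV)
        (\<lambda>(x, y). blinfun_mult_right (double_series (diffs2 a) x y))"
      by (simp add: case_prod_unfold bounded_linear.continuous[OF bounded_linear_blinfun_mult_right])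
  qed auto
  then show ?thesis by simp
qed

lemma even_series_eq_double_series:
  assumes "\<And>x y. ((\<lambda>(l, m). c l m * x ^ (2 * l) * y ^ (2 * m)) has_sum G x y) UNIV"
  obtains a where "entire_coeffs a" "G = double_series a"
proof -
  \<comment> \<open>Pad the coefficients with zeros at the positions where one of the exponents is odd.\<close>
  define a where "a l m = (if even l \<and> even m then c (l div 2) (m div 2) else 0)" for l m
  define h :: "nat \<times> nat \<Rightarrow> nat \<times> nat" where "h = (\<lambda>(l, m). (2 * l, 2 * m))"
  have h: "inj h" by (auto simp: h_def inj_on_def)
  have "((\<lambda>(l, m). a l m * x ^ l * y ^ m) has_sum G x y) UNIV" for x y
  proof -
    have "((\<lambda>(l, m). a l m * x ^ l * y ^ m) \<circ> h has_sum G x y) UNIV"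
      using assms[of x y] by (simp add: a_def h_def o_def case_prod_unfold)
    then have "((\<lambda>(l, m). a l m * x ^ l * y ^ m) has_sum G x y) (range h)"
      using h by (simp add: has_sum_reindex)
    moreover have "a l m = 0" if "(l, m) \<notin> range h" for l m
      using that by (fastforce simp: a_def h_def elim!: evenE)
    ultimately show ?thesis
      by (subst has_sum_cong_neutral[where T = "range h"]) auto
  qed
  then have "entire_coeffs a" "G = double_series a"
    by (auto simp: entire_coeffs_def double_series_def fun_eq_iff infsumI[symmetric]
        intro: has_sum_imp_summable)
  then show ?thesis by (rule that)
qed

lemma even_series_has_derivative:
  assumes "\<And>x y. ((\<lambda>(l, m). c l m * x ^ (2 * l) * y ^ (2 * m)) has_sum G x y) UNIV"
  shows "((\<lambda>(x, y). G x y) has_derivative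
      (\<lambda>(h, k). partial_deriv 1 0 G x y * h + partial_deriv 0 1 G x y * k)) (at (x, y))"
    and "(\<lambda>(x, y). partial_deriv 1 0 G x y) differentiable (at (x, y))"
    and "(\<lambda>(x, y). partial_deriv 0 1 G x y) differentiable (at (x, y))"
proof -
  obtain a where a: "entire_coeffs a" "G = double_series a"
    using even_series_eq_double_series[OF assms] by metis
  have g: "partial_deriv 1 0 G = double_series (diffs1 a)"
      "partial_deriv 0 1 G = double_series (diffs2 a)"
    using DERIV_double_series1[OF a(1)] DERIV_double_series2[OF a(1)]
    by (auto simp: a(2) partial_deriv_def fun_eq_iff intro!: DERIV_imp_deriv)
  show "((\<lambda>(x, y). G x y) has_derivative
      (\<lambda>(h, k). partial_deriv 1 0 G x y * h + partial_deriv 0 1 G x y * k)) (at (x, y))"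
    unfolding g unfolding a(2) by (rule has_derivative_double_series[OF a(1)])
  show "(\<lambda>(x, y). partial_deriv 1 0 G x y) differentiable (at (x, y))"
      "(\<lambda>(x, y). partial_deriv 0 1 G x y) differentiable (at (x, y))"
    unfolding g using a(1) entire_coeffs_diffs1 entire_coeffs_diffs2 has_derivative_double_series
    by (blast intro: differentiableI)+
qed

section \<open>Equilibria are not reached in finite time\<close>

text \<open>Differentiability at the zero \<open>e\<close> of the field gives \<open>norm (X y) \<le> L * norm (y - e)\<close> nearby. On a
  time interval of radius at most \<open>1 / (2 * L)\<close> around a moment at which \<open>z = e\<close>, the mean value
  inequality then bounds the maximal distance of \<open>z\<close> from \<open>e\<close> by half of itself. So the set of times
  with \<open>z = e\<close> is open; by continuity it is also closed in the connected time domain.\<close>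

lemma stays_at_equilibrium:
  fixes X :: "'a::real_normed_vector \<Rightarrow> 'a"
  assumes X: "X differentiable (at e)" "X e = 0"
    and I: "open I" "is_interval I"
    and z: "\<And>s. s \<in> I \<Longrightarrow> (z has_vector_derivative X (z s)) (at s)"
    and "t0 \<in> I" "z t0 = e" "t \<in> I"
  shows "z t = e"
proof -
  obtain X' d where X': "bounded_linear X'" and "d > 0"
    and d: "\<And>y. norm (y - e) < d \<Longrightarrow> norm (X y - X' (y - e)) \<le> norm (y - e)"
    using X unfolding differentiable_def has_derivative_at_alt
    by (metis mult_1 zero_less_one diff_zero)
  define L where "L = onorm X' + 1"
  have "L > 0"
    using onorm_pos_le[OF X'] by (simp add: L_def)
  have lip: "norm (X y) \<le> L * norm (y - e)" if "norm (y - e) < d" for y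
    using d[OF that] onorm[OF X', of "y - e"] norm_triangle_ineq2[of "X y" "X' (y - e)"]
    by (simp add: L_def algebra_simps)
  have cont: "isCont z s" if "s \<in> I" for s
    using z[OF that] by (rule has_vector_derivative_continuous)
  \<comment> \<open>Being at \<open>e\<close> is a locally constant property of the time.\<close>
  have "\<forall>a\<in>I. \<forall>\<^sub>F b in at a within I. (z a = e) = (z b = e)"
  proof
    fix a assume "a \<in> I"
    show "\<forall>\<^sub>F b in at a within I. (z a = e) = (z b = e)"
    proof (cases "z a = e")
      case False
      have "(z \<longlongrightarrow> z a) (at a within I)"
        using cont[OF \<open>a \<in> I\<close>] by (simp add: continuous_at_imp_continuous_at_within flip: continuous_within)
      then have "\<forall>\<^sub>F b in at a within I. z b \<noteq> e"
        using False by (rule tendsto_imp_eventually_ne)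
      with False show ?thesis by simp
    next
      case True
      have "\<forall>\<^sub>F s in nhds a. s \<in> I"
        using I(1) \<open>a \<in> I\<close> by (rule eventually_nhds_in_open)
      moreover have "(z \<longlongrightarrow> e) (nhds a)"
        using cont[OF \<open>a \<in> I\<close>] True tendsto_at_iff_tendsto_nhds[of z a] by (simp add: isCont_def)
      then have "\<forall>\<^sub>F s in nhds a. norm (z s - e) < d"
        using \<open>d > 0\<close> by (auto simp: dist_norm dest: tendstoD)
      ultimately have "\<forall>\<^sub>F s in nhds a. s \<in> I \<and> norm (z s - e) < d"
        by (rule eventually_conj)
      then obtain r where "r > 0" and r: "\<And>s. dist s a < r \<Longrightarrow> s \<in> I \<and> norm (z s - e) < d"
        by (auto simp: eventually_nhds_metric)
      define \<delta> where "\<delta> = min (r / 2) (1 / (2 * L))"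
      have "\<delta> > 0" "\<delta> < r" "L * \<delta> \<le> 1 / 2"
        using \<open>r > 0\<close> \<open>L > 0\<close> by (auto simp: \<delta>_def min_def field_simps)
      define J where "J = {a - \<delta>..a + \<delta>}"
      have J: "s \<in> I" "norm (z s - e) < d" if "s \<in> J" for s
        using r[of s] that \<open>\<delta> < r\<close> by (auto simp: J_def dist_real_def)
      have "continuous_on J (\<lambda>s. norm (z s - e))"
        using J cont by (intro continuous_intros continuous_at_imp_continuous_on) auto
      then obtain m where m: "m \<in> J" "\<And>s. s \<in> J \<Longrightarrow> norm (z s - e) \<le> norm (z m - e)"
        using continuous_attains_sup[of J "\<lambda>s. norm (z s - e)"] \<open>\<delta> > 0\<close> by (auto simp: J_def)
      define M where "M = norm (z m - e)"
      have "norm (z m - z a) \<le> (L * M) * norm (m - a)"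
      proof (rule differentiable_bound)
        show "convex J" "m \<in> J" "a \<in> J"
          using m \<open>\<delta> > 0\<close> by (auto simp: J_def)
        fix s assume "s \<in> J"
        show "(z has_derivative (\<lambda>h. h *\<^sub>R X (z s))) (at s within J)"
          using z[OF J(1)[OF \<open>s \<in> J\<close>]]
          by (simp add: has_vector_derivative_def has_derivative_at_withinI)
        have "norm (X (z s)) \<le> L * norm (z s - e)"
          using J[OF \<open>s \<in> J\<close>] by (intro lip)
        also have "\<dots> \<le> L * M"
          using m(2)[OF \<open>s \<in> J\<close>] \<open>L > 0\<close> by (simp add: M_def)
        finally show "onorm (\<lambda>h. h *\<^sub>R X (z s)) \<le> L * M"
          by (intro onorm_le) (simp add: mult.commute mult_left_mono)
      qed
      also have "\<dots> \<le> (L * M) * \<delta>"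
        using m(1) \<open>L > 0\<close> by (intro mult_left_mono) (auto simp: J_def M_def abs_le_iff)
      also have "\<dots> \<le> M / 2"
        using mult_right_mono[OF \<open>L * \<delta> \<le> 1 / 2\<close>, of M] by (simp add: M_def mult_ac)
      finally have "M = 0"
        using True by (simp add: M_def)
      then have "z s = e" if "s \<in> J" for s
        using m(2)[OF that] by (simp add: M_def)
      moreover have "s \<in> J" if "dist s a < \<delta>" for s
        using that by (auto simp: J_def dist_real_def abs_less_iff)
      ultimately have "\<forall>\<^sub>F s in at a within I. z s = e"
        using \<open>\<delta> > 0\<close> unfolding eventually_at by blast
      with True show ?thesis by simp
    qed
  qed
  then have "(z t0 = e) = (z t = e)"
    using I assms(6,8) by (intro connected_local_const[of I t0 t "\<lambda>s. z s = e"])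
      (auto simp: is_interval_connected_1)
  with assms(7) show ?thesis by simp
qed

section \<open>Sums over edges\<close>

text \<open>Each edge contributes \<open>f i j * v i\<close> from one orientation and \<open>f j i * v j = - f i j * v j\<close> from
  the other. This turns the derivative of the interaction energy, a sum over edges, into the
  vertexwise forces of the equations of motion.\<close>

lemma sum_edges_antisym:
  fixes E :: "'n::{finite,linorder} set set" and f :: "'n \<Rightarrow> 'n \<Rightarrow> real"
  assumes "simple_graph E" and antisym: "\<And>i j. f j i = - f i j"
  shows "(\<Sum>(i, j) | i < j \<and> {i, j} \<in> E. f i j * (v i - v j))
       = (\<Sum>i\<in>UNIV. v i * (\<Sum>j\<in>UNIV. adjacency E i j * f i j))"
proof -
  define P where "P = {(i, j). i < j \<and> {i, j} \<in> E}"
  define Q where "Q = {(i, j). j < i \<and> {i, j} \<in> E}"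
  have loop: "{i, i} \<notin> E" for i
    using assms(1) by (force simp: simple_graph_def)
  have "(\<Sum>i\<in>UNIV. v i * (\<Sum>j\<in>UNIV. adjacency E i j * f i j))
      = (\<Sum>(i, j)\<in>UNIV. adjacency E i j * f i j * v i)"
    by (simp add: sum_distrib_left sum.cartesian_product mult_ac)
  also have "\<dots> = (\<Sum>(i, j)\<in>P \<union> Q. f i j * v i)"
  proof (rule sum.mono_neutral_cong_right)
    have "(i, j) \<in> P \<union> Q" if "{i, j} \<in> E" for i j
      using that loop[of i] by (cases i j rule: linorder_cases) (auto simp: P_def Q_def)
    then have zero: "adjacency E i j = 0" if "(i, j) \<notin> P \<union> Q" for i j
      using that by (auto simp only: adjacency_def split: if_splits)
    show "\<forall>x\<in>UNIV - (P \<union> Q). (case x of (i, j) \<Rightarrow> adjacency E i j * f i j * v i) = 0"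
    proof
      fix x assume "x \<in> UNIV - (P \<union> Q)"
      then show "(case x of (i, j) \<Rightarrow> adjacency E i j * f i j * v i) = 0"
        using zero[of "fst x" "snd x"] by (cases x) auto
    qed
  qed (auto simp: P_def Q_def adjacency_def)
  also have "\<dots> = (\<Sum>(i, j)\<in>P. f i j * v i) + (\<Sum>(i, j)\<in>Q. f i j * v i)"
    by (intro sum.union_disjoint) (auto simp: P_def Q_def)
  also have "(\<Sum>(i, j)\<in>Q. f i j * v i) = (\<Sum>(i, j)\<in>P. f j i * v j)"
    by (rule sum.reindex_bij_witness[of _ prod.swap prod.swap])
       (auto simp: P_def Q_def insert_commute)
  also have "\<dots> = (\<Sum>(i, j)\<in>P. - f i j * v j)"
  proof (intro sum.cong refl, clarify)
    show "f j i * v j = - f i j * v j" for i j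
      using antisym[where i = i and j = j] by (rule arg_cong)
  qed
  also have "(\<Sum>(i, j)\<in>P. f i j * v i) + \<dots> = (\<Sum>(i, j)\<in>P. f i j * (v i - v j))"
    by (simp add: case_prod_unfold right_diff_distrib flip: sum.distrib)
  finally show ?thesis by (simp add: P_def)
qed

section \<open>The barriers of the pinning potential\<close>

lemma exists_cos_eq_minus_one:
  assumes "a + 2 * pi \<le> b"
  shows "\<exists>c\<in>{a..b}. cos c = -1"
proof -
  define k where "k = \<lceil>(a - pi) / (2 * pi)\<rceil>"
  \<comment> \<open>The first odd multiple of \<open>pi\<close> that is not below \<open>a\<close>.\<close>
  define c where "c = pi + 2 * pi * of_int k"
  have "(a - pi) / (2 * pi) \<le> of_int k" "of_int k < (a - pi) / (2 * pi) + 1"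
    unfolding k_def by linarith+
  then have "a \<le> c" "c \<le> b"
    using assms pi_gt_zero by (auto simp: c_def field_simps)
  moreover have "cos c = -1"
    using cos_int_2pin[of k] sin_int_2pin[of k] by (simp add: c_def cos_add)
  ultimately show ?thesis by auto
qed

lemma cos_barrier:
  fixes f :: "real \<Rightarrow> real"
  assumes "continuous_on I f" "is_interval I" "s \<in> I" "t \<in> I"
    and "\<And>r. r \<in> I \<Longrightarrow> cos (f r) \<noteq> -1"
  shows "\<bar>f t - f s\<bar> < 2 * pi"
proof (rule ccontr)
  assume "\<not> ?thesis"
  then have "\<exists>a\<in>f ` I. \<exists>b\<in>f ` I. a + 2 * pi \<le> b"
    using assms(3,4) by (smt (verit, best) imageI)
  then obtain a b where ab: "a \<in> f ` I" "b \<in> f ` I" "a + 2 * pi \<le> b" by blast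
  obtain c where c: "c \<in> {a..b}" "cos c = -1"
    using exists_cos_eq_minus_one[OF ab(3)] by blast
  have "connected (f ` I)"
    using assms(1,2) by (auto intro: connected_continuous_image simp: is_interval_connected_1)
  then have "c \<in> f ` I"
    using connected_contains_Icc[OF _ ab(1,2)] c(1) by blast
  with assms(5) c(2) show False by auto
qed

section \<open>The Hamiltonian system\<close>

text \<open>The dynamics depends on the power series only through these properties. Invariance under the
  point reflection \<open>(x, y) \<mapsto> (-x, -y)\<close> is what makes the interaction of an edge independent of its
  orientation.\<close>

locale even_interaction =
  fixes G :: "real \<Rightarrow> real \<Rightarrow> real"
  assumes has_derivative: "((\<lambda>(x, y). G x y) has_derivative
      (\<lambda>(h, k). partial_deriv 1 0 G x y * h + partial_deriv 0 1 G x y * k)) (at (x, y))"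
    and differentiable_partials:
      "(\<lambda>(x, y). partial_deriv 1 0 G x y) differentiable (at (x, y))"
      "(\<lambda>(x, y). partial_deriv 0 1 G x y) differentiable (at (x, y))"
    and even: "G (- x) (- y) = G x y"
begin

lemma DERIV_partials:
  "((\<lambda>u. G u y) has_real_derivative partial_deriv 1 0 G x y) (at x)"
  "((\<lambda>v. G x v) has_real_derivative partial_deriv 0 1 G x y) (at y)"
proof -
  have "((\<lambda>u. (u, y)) has_derivative (\<lambda>h. (h, 0))) (at x)"
       "((\<lambda>v. (x, v)) has_derivative (\<lambda>h. (0, h))) (at y)"
    by (auto intro!: derivative_eq_intros)
  from this[THEN has_derivative_compose, OF has_derivative]
  show "((\<lambda>u. G u y) has_real_derivative partial_deriv 1 0 G x y) (at x)"
       "((\<lambda>v. G x v) has_real_derivative partial_deriv 0 1 G x y) (at y)"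
    by (simp_all add: has_field_derivative_def)
qed

lemma odd_partials:
  "partial_deriv 1 0 G (- x) (- y) = - partial_deriv 1 0 G x y"
  "partial_deriv 0 1 G (- x) (- y) = - partial_deriv 0 1 G x y"
proof -
  have "((\<lambda>u. G (- u) (- y)) has_real_derivative - partial_deriv 1 0 G (- x) (- y)) (at x)"
       "((\<lambda>v. G (- x) (- v)) has_real_derivative - partial_deriv 0 1 G (- x) (- y)) (at y)"
    using DERIV_mirror[THEN iffD1, OF DERIV_partials(1)[of "- y" "- x"]]
      DERIV_mirror[THEN iffD1, OF DERIV_partials(2)[of "- x" "- y"]] by auto
  from this[unfolded even] DERIV_partials[of y x] DERIV_partials[of x y]
  show "partial_deriv 1 0 G (- x) (- y) = - partial_deriv 1 0 G x y"
       "partial_deriv 0 1 G (- x) (- y) = - partial_deriv 0 1 G x y"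
    by (metis DERIV_unique minus_minus)+
qed

lemma partials_eq_0_at_zero:
  assumes "\<And>x y. 0 \<le> G x y" "G x y = 0"
  shows "partial_deriv 1 0 G x y = 0" "partial_deriv 0 1 G x y = 0"
  using DERIV_local_min[OF DERIV_partials(1)[of y x], of 1]
    DERIV_local_min[OF DERIV_partials(2)[of x y], of 1] assms by auto

lemma DERIV_along_curve:
  assumes "(x has_real_derivative x') (at t)" "(y has_real_derivative y') (at t)"
  shows "((\<lambda>t. G (x t) (y t)) has_real_derivative
    partial_deriv 1 0 G (x t) (y t) * x' + partial_deriv 0 1 G (x t) (y t) * y') (at t)"
proof -
  have "((\<lambda>t. (x t, y t)) has_derivative (\<lambda>h. (x' * h, y' * h))) (at t)"
    using assms by (intro has_derivative_Pair) (simp_all add: has_field_derivative_def)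
  from has_derivative_compose[OF this has_derivative]
  have "((\<lambda>t. G (x t) (y t)) has_derivative (\<lambda>h. partial_deriv 1 0 G (x t) (y t) * (x' * h)
      + partial_deriv 0 1 G (x t) (y t) * (y' * h))) (at t)"
    by simp
  then show ?thesis
    unfolding has_field_derivative_def
    by (rule has_derivative_eq_rhs) (simp add: fun_eq_iff algebra_simps)
qed

text \<open>After the sum over edges is rewritten as a sum over vertices, the contribution of the vertex \<open>i\<close>
  is \<open>q\<^sub>i' * (- p\<^sub>i') + p\<^sub>i' * q\<^sub>i' = 0\<close> by the equations of motion.\<close>

lemma hamiltonian_conserved:
  fixes E :: "'n::{finite,linorder} set set"
  assumes "simple_graph E"
    and z: "(z has_vector_derivative hamiltonian_field \<kappa> E G (z t)) (at t)"
  shows "((\<lambda>s. hamiltonian \<kappa> E G (z s)) has_real_derivative 0) (at t)"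
proof -
  define q p where "q s i = fst (z s) $ i" and "p s i = snd (z s) $ i" for s i
  define g1 g2 where "g1 i j = partial_deriv 1 0 G (q t i - q t j) (p t i - p t j)"
    and "g2 i j = partial_deriv 0 1 G (q t i - q t j) (p t i - p t j)" for i j
  define q' p' where "q' i = p t i + \<kappa> * (\<Sum>j\<in>UNIV. adjacency E i j * g2 i j)"
    and "p' i = - sin (q t i) - \<kappa> * (\<Sum>j\<in>UNIV. adjacency E i j * g1 i j)" for i
  have "((\<lambda>s. q s i) has_real_derivative fst (hamiltonian_field \<kappa> E G (z t)) $ i) (at t)"
       "((\<lambda>s. p s i) has_real_derivative snd (hamiltonian_field \<kappa> E G (z t)) $ i) (at t)" for i
    unfolding has_real_derivative_iff_has_vector_derivative q_def p_def
    by (intro bounded_linear.has_vector_derivative[OF _ z]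
        bounded_linear_compose[OF bounded_linear_vec_nth] bounded_linear_fst bounded_linear_snd)+
  then have q': "((\<lambda>s. q s i) has_real_derivative q' i) (at t)"
    and p': "((\<lambda>s. p s i) has_real_derivative p' i) (at t)" for i
    by (simp_all add: hamiltonian_field_def case_prod_unfold q'_def p'_def g1_def g2_def q_def p_def)
  have anti: "g1 j i = - g1 i j" "g2 j i = - g2 i j" for i j
    using odd_partials[of "q t i - q t j" "p t i - p t j"] by (simp_all add: g1_def g2_def)
  have H: "hamiltonian \<kappa> E G (z s) = (\<Sum>i\<in>UNIV. (p s i)\<^sup>2 / 2 - cos (q s i))
      + \<kappa> * (\<Sum>(i, j) | i < j \<and> {i, j} \<in> E. G (q s i - q s j) (p s i - p s j))" for s
    by (simp add: hamiltonian_def case_prod_unfold q_def p_def)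
  have "((\<lambda>s. hamiltonian \<kappa> E G (z s)) has_real_derivative
      (\<Sum>i\<in>UNIV. p t i * p' i + sin (q t i) * q' i)
      + \<kappa> * (\<Sum>(i, j) | i < j \<and> {i, j} \<in> E. g1 i j * (q' i - q' j) + g2 i j * (p' i - p' j))) (at t)"
    unfolding H case_prod_unfold g1_def g2_def
    by (intro DERIV_add DERIV_cmult DERIV_sum DERIV_along_curve DERIV_diff q' p')
       (auto intro!: derivative_eq_intros q' p')
  moreover have "(\<Sum>(i, j) | i < j \<and> {i, j} \<in> E. g1 i j * (q' i - q' j) + g2 i j * (p' i - p' j))
      = (\<Sum>i\<in>UNIV. q' i * (\<Sum>j\<in>UNIV. adjacency E i j * g1 i j))
      + (\<Sum>i\<in>UNIV. p' i * (\<Sum>j\<in>UNIV. adjacency E i j * g2 i j))"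
    unfolding sum_edges_antisym[of E g1, OF assms(1) anti(1), symmetric]
      sum_edges_antisym[of E g2, OF assms(1) anti(2), symmetric]
    by (simp add: case_prod_unfold sum.distrib)
  moreover have "p t i * p' i + sin (q t i) * q' i
      + \<kappa> * (q' i * (\<Sum>j\<in>UNIV. adjacency E i j * g1 i j)
           + p' i * (\<Sum>j\<in>UNIV. adjacency E i j * g2 i j)) = 0" for i
    by (simp add: q'_def p'_def algebra_simps)
  ultimately show ?thesis
    by (simp add: sum_distrib_left distrib_left flip: sum.distrib)
qed

lemma hamiltonian_field_differentiable:
  fixes z :: "(real^'n::finite) \<times> (real^'n::finite)"
  shows "hamiltonian_field \<kappa> E G differentiable (at z)"
proof -
  have lin: "(\<lambda>z. fst z $ i) differentiable (at z)" "(\<lambda>z. snd z $ i) differentiable (at z)"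
    for i :: "'n::finite" and z :: "(real^'n::finite) \<times> (real^'n::finite)"
    by (intro bounded_linear_imp_differentiable
        bounded_linear_compose[OF bounded_linear_vec_nth] bounded_linear_fst bounded_linear_snd)+
  have dist: "(\<lambda>z. (fst z $ i - fst z $ j, snd z $ i - snd z $ j)) differentiable (at z)"
    for i j :: "'n::finite" and z :: "(real^'n::finite) \<times> (real^'n::finite)"
    by (intro differentiable_Pair differentiable_diff lin)
  have partials:
    "(\<lambda>z. partial_deriv 1 0 G (fst z $ i - fst z $ j) (snd z $ i - snd z $ j)) differentiable (at z)"
    "(\<lambda>z. partial_deriv 0 1 G (fst z $ i - fst z $ j) (snd z $ i - snd z $ j)) differentiable (at z)"
    for i j :: "'n::finite" and z :: "(real^'n::finite) \<times> (real^'n::finite)"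
    using differentiable_chain_at[OF dist differentiable_partials(1), of i j z]
      differentiable_chain_at[OF dist differentiable_partials(2), of i j z]
    by (simp_all add: o_def)
  have sin: "(\<lambda>z. sin (fst z $ i)) differentiable (at z)"
    for i :: "'n::finite" and z :: "(real^'n::finite) \<times> (real^'n::finite)"
    using differentiable_chain_at[OF lin(1)[where i = i and z = z]
        field_differentiable_imp_differentiable[OF field_differentiable_at_sin]]
    by (simp add: o_def)
  show ?thesis
    unfolding hamiltonian_field_def case_prod_unfold
    by (intro differentiable_Pair; subst differentiable_componentwise_within)
       (auto simp: Basis_vec_def inner_axis simp del: One_nat_def intro!: lin partials sin derivative_intros)
qed

end

lemma kinetic_pinning_nonneg: "0 \<le> p\<^sup>2 / 2 + (1 - cos q)" for p q :: real
  by (simp add: add_nonneg_nonneg)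

text \<open>The constant \<open>N\<close> makes every summand nonnegative, so that each of them is bounded by the whole.\<close>

lemma hamiltonian_shift:
  fixes z :: "(real^'n::{finite,linorder}) \<times> (real^'n::{finite,linorder})"
  shows "hamiltonian \<kappa> E G z + real CARD('n)
    = (\<Sum>i\<in>UNIV. (snd z $ i)\<^sup>2 / 2 + (1 - cos (fst z $ i)))
    + \<kappa> * (\<Sum>(i, j) | i < j \<and> {i, j} \<in> E. G (fst z $ i - fst z $ j) (snd z $ i - snd z $ j))"
proof -
  have "(\<Sum>i\<in>UNIV. (snd z $ i)\<^sup>2 / 2 + (1 - cos (fst z $ i)))
      = (\<Sum>i\<in>UNIV. (snd z $ i)\<^sup>2 / 2 - cos (fst z $ i)) + (\<Sum>i\<in>(UNIV::'n set). 1)"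
    unfolding sum.distrib[symmetric] by (simp add: algebra_simps)
  then show ?thesis
    by (simp add: hamiltonian_def case_prod_unfold)
qed

lemma momentum_bound:
  fixes z :: "(real^'n::{finite,linorder}) \<times> (real^'n::{finite,linorder})"
  assumes "\<kappa> \<ge> 0" "\<And>x y. 0 \<le> G x y" "hamiltonian \<kappa> E G z \<le> 2 - real CARD('n)"
  shows "\<bar>snd z $ i\<bar> \<le> 2"
proof -
  have "(snd z $ i)\<^sup>2 / 2 \<le> (snd z $ i)\<^sup>2 / 2 + (1 - cos (fst z $ i))" by simp
  also have "\<dots> \<le> (\<Sum>i\<in>UNIV. (snd z $ i)\<^sup>2 / 2 + (1 - cos (fst z $ i)))"
    by (rule member_le_sum) (auto intro: kinetic_pinning_nonneg)
  also have "\<dots> \<le> hamiltonian \<kappa> E G z + real CARD('n)"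
    unfolding hamiltonian_shift using assms(1,2) by (auto intro!: mult_nonneg_nonneg sum_nonneg)
  also have "\<dots> \<le> 2" using assms(3) by simp
  finally have "(snd z $ i)\<^sup>2 \<le> 2\<^sup>2" by simp
  then show ?thesis
    by (simp only: abs_le_square_iff[symmetric] abs_numeral)
qed

text \<open>An inverted pendulum contributes \<open>1 - cos q\<^sub>i = 2\<close>, which is all the shifted energy available. Every
  other nonnegative term of that energy is therefore zero.\<close>

lemma (in even_interaction) inverted_pendulum_equilibrium:
  fixes z :: "(real^'n::{finite,linorder}) \<times> (real^'n::{finite,linorder})"
  assumes "simple_graph E" "\<kappa> > 0" and G: "\<And>x y. 0 \<le> G x y"
    and "hamiltonian \<kappa> E G z \<le> 2 - real CARD('n)" and i: "cos (fst z $ i) = -1"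
  shows "hamiltonian_field \<kappa> E G z = 0"
proof -
  define T where "T j = (snd z $ j)\<^sup>2 / 2 + (1 - cos (fst z $ j))" for j
  define W where "W = (\<Sum>(j, k) | j < k \<and> {j, k} \<in> E.
    G (fst z $ j - fst z $ k) (snd z $ j - snd z $ k))"
  have T: "0 \<le> T j" for j
    unfolding T_def by (rule kinetic_pinning_nonneg)
  have "0 \<le> W"
    using G by (auto simp: W_def intro!: sum_nonneg)
  have "T i + sum T (UNIV - {i}) + \<kappa> * W \<le> 2"
    using assms(4) hamiltonian_shift[of \<kappa> E G z]
    by (simp add: T_def W_def sum.remove[of UNIV i])
  then have le: "(snd z $ i)\<^sup>2 / 2 + sum T (UNIV - {i}) + \<kappa> * W \<le> 0"
    by (simp add: T_def i)
  have nonneg: "0 \<le> (snd z $ i)\<^sup>2 / 2" "0 \<le> sum T (UNIV - {i})" "0 \<le> \<kappa> * W"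
    using T \<open>0 \<le> W\<close> \<open>\<kappa> > 0\<close> by (auto intro: sum_nonneg)
  have "(snd z $ i)\<^sup>2 / 2 = 0" "sum T (UNIV - {i}) = 0" "\<kappa> * W = 0"
    using le nonneg by linarith+
  then have "snd z $ i = 0" and T0: "\<And>j. j \<noteq> i \<Longrightarrow> T j = 0" and W0: "W = 0"
    using T \<open>\<kappa> > 0\<close> by (auto simp: sum_nonneg_eq_0_iff)
  have rest: "snd z $ j = 0 \<and> sin (fst z $ j) = 0" for j
  proof (cases "j = i")
    case True
    then show ?thesis
      using \<open>snd z $ i = 0\<close> i sin_cos_squared_add[of "fst z $ i"] by simp
  next
    case False
    have "(snd z $ j)\<^sup>2 \<ge> 0" "cos (fst z $ j) \<le> 1" by simp_all
    with T0[OF False] have "(snd z $ j)\<^sup>2 = 0" "cos (fst z $ j) = 1"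
      unfolding T_def by linarith+
    then show ?thesis
      using sin_cos_squared_add[of "fst z $ j"] by simp
  qed
  have ordered: "G (fst z $ j - fst z $ k) (snd z $ j - snd z $ k) = 0"
    if "j < k" "{j, k} \<in> E" for j k
    using W0 that G unfolding W_def
    by (subst (asm) sum_nonneg_eq_0_iff) (auto intro: finite_subset[OF subset_UNIV])
  have edge: "G (fst z $ j - fst z $ k) (snd z $ j - snd z $ k) = 0" if "{j, k} \<in> E" for j k
  proof -
    have "j \<noteq> k"
      using that \<open>simple_graph E\<close> by (force simp: simple_graph_def)
    then consider "j < k" | "k < j" by fastforce
    then show ?thesis
    proof cases
      case 2
      then have "G (fst z $ k - fst z $ j) (snd z $ k - snd z $ j) = 0"
        using ordered that by (simp add: insert_commute)
      then show ?thesis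
        using even[of "fst z $ k - fst z $ j" "snd z $ k - snd z $ j"] by simp
    qed (use ordered that in auto)
  qed
  have "adjacency E j k * partial_deriv 1 0 G (fst z $ j - fst z $ k) (snd z $ j - snd z $ k) = 0"
       "adjacency E j k * partial_deriv 0 1 G (fst z $ j - fst z $ k) (snd z $ j - snd z $ k) = 0" for j k
    using partials_eq_0_at_zero[OF G edge[of j k]] by (auto simp: adjacency_def)
  then have "(\<Sum>k\<in>UNIV. adjacency E j k
        * partial_deriv 1 0 G (fst z $ j - fst z $ k) (snd z $ j - snd z $ k)) = 0"
      "(\<Sum>k\<in>UNIV. adjacency E j k
        * partial_deriv 0 1 G (fst z $ j - fst z $ k) (snd z $ j - snd z $ k)) = 0" for j
    by (simp_all only: sum.neutral_const)
  then show ?thesis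
    using rest by (simp add: hamiltonian_field_def case_prod_unfold vec_eq_iff prod_eq_iff)
qed

theorem proposition1:
  fixes E :: "'n::{finite,linorder} set set"
    and \<kappa> :: real
    and c :: "nat \<Rightarrow> nat \<Rightarrow> real"
    and G :: "real \<Rightarrow> real \<Rightarrow> real"
    and z0 :: "(real^'n::{finite,linorder}) \<times> (real^'n::{finite,linorder})"
  assumes "CARD('n) \<ge> 2"
    and "simple_graph E"
    and "\<kappa> > 0"
    and "\<And>x y. ((\<lambda>(l, m). c l m * x ^ (2 * l) * y ^ (2 * m)) has_sum G x y) UNIV"
    and "\<And>x y. G x y \<ge> 0"
    and "hamiltonian \<kappa> E G z0 \<le> 2 - real CARD('n)"
  shows "bounded (orbit (hamiltonian_field \<kappa> E G) z0)"
proof -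
  have "G (- x) (- y) = G x y" for x y
    using has_sum_unique[OF assms(4)[of "- x" "- y"]] assms(4)[of x y] by simp
  then interpret even_interaction G
    by unfold_locales (use even_series_has_derivative[OF assms(4)] in auto)
  define B where "B = (\<Sum>i\<in>UNIV. \<bar>fst z0 $ i\<bar> + 2 * pi) + (\<Sum>i\<in>(UNIV :: 'n set). 2)"
  show ?thesis
  proof (rule boundedI)
    fix w assume "w \<in> orbit (hamiltonian_field \<kappa> E G) z0"
    then obtain z I t where w: "w = z t" and I: "open I" "is_interval I" "0 \<in> I" "t \<in> I"
      and z0: "z 0 = z0"
      and z: "\<And>s. s \<in> I \<Longrightarrow> (z has_vector_derivative hamiltonian_field \<kappa> E G (z s)) (at s)"
      unfolding orbit_def by auto
    have energy: "hamiltonian \<kappa> E G (z s) \<le> 2 - real CARD('n)" if "s \<in> I" for s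
    proof -
      have "hamiltonian \<kappa> E G (z s) = hamiltonian \<kappa> E G (z 0)"
        using I that hamiltonian_conserved[OF assms(2) z]
        by (intro has_derivative_zero_unique_connected[of I "\<lambda>s. hamiltonian \<kappa> E G (z s)"])
           (auto simp: is_interval_connected_1 has_field_derivative_def lambda_zero)
      with z0 assms(6) show ?thesis by simp
    qed
    show "norm w \<le> norm z0 + B"
    proof (cases "\<exists>s\<in>I. \<exists>i. cos (fst (z s) $ i) = -1")
      case True
      then obtain s i where "s \<in> I" "cos (fst (z s) $ i) = -1" by blast
      then have "hamiltonian_field \<kappa> E G (z s) = 0"
        using assms(2,3,5) energy by (intro inverted_pendulum_equilibrium)
      then have rest: "z r = z s" if "r \<in> I" for r
        using stays_at_equilibrium[OF hamiltonian_field_differentiable _ I(1,2) z \<open>s \<in> I\<close> refl that]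
        by simp
      then have "w = z0"
        using w z0 I(3,4) rest[OF I(3)] rest[OF I(4)] by simp
      moreover have "0 \<le> B"
        by (auto simp: B_def intro!: add_nonneg_nonneg sum_nonneg)
      ultimately show ?thesis by simp
    next
      case False
      have "continuous_on I z"
        using z by (intro continuous_at_imp_continuous_on ballI has_vector_derivative_continuous)
      then have "continuous_on I (\<lambda>s. fst (z s) $ i)" for i
        by (intro continuous_intros)
      then have near: "\<bar>fst w $ i - fst z0 $ i\<bar> < 2 * pi" for i
        using False I w z0 cos_barrier[of I "\<lambda>s. fst (z s) $ i" 0 t] by blast
      have q: "\<bar>fst w $ i\<bar> \<le> \<bar>fst z0 $ i\<bar> + 2 * pi" for i
        using near[of i] by linarith
      have p: "\<bar>snd w $ i\<bar> \<le> 2" for i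
        using momentum_bound[of \<kappa> G E w i] assms(3,5) energy[OF I(4)] w by simp
      have "norm w \<le> norm (fst w) + norm (snd w)"
        using norm_Pair_le[of "fst w" "snd w"] by simp
      also have "\<dots> \<le> (\<Sum>i\<in>UNIV. \<bar>fst w $ i\<bar>) + (\<Sum>i\<in>UNIV. \<bar>snd w $ i\<bar>)"
        by (intro add_mono norm_le_l1_cart)
      also have "\<dots> \<le> B"
        unfolding B_def by (intro add_mono sum_mono q p)
      also have "\<dots> \<le> norm z0 + B" by simp
      finally show ?thesis .
    qed
  qed
qed

end
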